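(* Let $\Phi$ be an irreducible crystallographic root system spanning $V$, with Weyl group $W$, chamber $\mathcal C$ and alcove $\mathcal A$. (i) For $p\in\mathcal P\cap\mathcal C$, the eigenfunction $f_p(x)=\sum_{w\in W}\varepsilon(w)\exp(2\pi i\langle x,wp\rangle)$ of the Dirichlet Laplacian on $\mathcal A$ is real (up to a constant factor) if and only if $$\exists\,w_1\in W\ \text{ such that }\ w_1p=-p.\qquad( * )$$ If $( * )$ holds then, up to a constant factor, $$f_p(x)=\sum_{w\in W}\varepsilon(w)\,\mathrm{cs}(2\pi\langle x,wp\rangle),$$ where $\mathrm{cs}=\sin$ if $\varepsilon(w_1)=-1$ and $\mathrm{cs}=\cos$ if $\varepsilon(w_1)=1$. (ii) For $p\in\mathcal P\cap\overline{\mathcal C}$, the eigenfunction $g_p(x)=\sum_{w\in W}\exp(2\pi i\langle x,wp\rangle)$ of the Neumann Laplacian on $\mathcal A$ is real (up to a constant factor) if and only if $( * )$ holds, and then, up to a constant factor, $$g_p(x)=\sum_{w\in W}\cos(2\pi\langle x,wp\rangle).$$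
   Context: $V$ is a finite-dimensional real Euclidean space with inner product $\langle\cdot,\cdot\rangle$; $\Phi^+$ is a positive system of $\Phi$, $\mathcal C=\{x\in V:\langle\alpha,x\rangle>0\ \forall\alpha\in\Phi^+\}$, $\mathcal A=\{x\in V:0<\langle x,\alpha\rangle<1\ \forall\alpha\in\Phi^+\}$; $\alpha^\vee=2\alpha/\langle\alpha,\alpha\rangle$, $\mathcal P=\{x\in V:\langle\alpha^\vee,x\rangle\in\mathbb{Z}\ \forall\alpha\in\Phi\}$; $\varepsilon(w)=\det w$. It is a known result (Bérard) that the eigenfunctions for the Dirichlet Laplacian on $\mathcal A$ are $\{f_p:p\in\mathcal P\cap\mathcal C\}$ and those for the Neumann Laplacian are $\{g_p:p\in\mathcal P\cap\overline{\mathcal C}\}$. A function is "real up to a constant factor" if some nonzero complex constant multiple of it is real-valued. *)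

theory Defs
  imports "HOL-Analysis.Analysis"
begin

definition coroot :: "'a::euclidean_space \<Rightarrow> 'a"
  where "coroot \<alpha> = (2 / (\<alpha> \<bullet> \<alpha>)) *\<^sub>R \<alpha>"

definition root_reflection :: "'a::euclidean_space \<Rightarrow> 'a \<Rightarrow> 'a"
  where "root_reflection \<alpha> x = x - (coroot \<alpha> \<bullet> x) *\<^sub>R \<alpha>"

text \<open>Root systems are reduced, i.e. the only multiples of a root \<open>\<alpha>\<close> that are roots
  are \<open>\<alpha>\<close> and \<open>- \<alpha>\<close>.\<close>

definition root_system :: "'a::euclidean_space set \<Rightarrow> bool"
  where "root_system \<Phi> \<longleftrightarrow>
    finite \<Phi> \<and> 0 \<notin> \<Phi> \<and> span \<Phi> = UNIV \<and>
    (\<forall>\<alpha>\<in>\<Phi>. \<Phi> \<inter> span {\<alpha>} = {\<alpha>, - \<alpha>}) \<and>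
    (\<forall>\<alpha>\<in>\<Phi>. root_reflection \<alpha> ` \<Phi> = \<Phi>)"

definition crystallographic :: "'a::euclidean_space set \<Rightarrow> bool"
  where "crystallographic \<Phi> \<longleftrightarrow> (\<forall>\<alpha>\<in>\<Phi>. \<forall>\<beta>\<in>\<Phi>. coroot \<alpha> \<bullet> \<beta> \<in> \<int>)"

definition irreducible_roots :: "'a::euclidean_space set \<Rightarrow> bool"
  where "irreducible_roots \<Phi> \<longleftrightarrow> \<Phi> \<noteq> {} \<and>
    \<not> (\<exists>A B. A \<noteq> {} \<and> B \<noteq> {} \<and> A \<inter> B = {} \<and> A \<union> B = \<Phi> \<and>
         (\<forall>\<alpha>\<in>A. \<forall>\<beta>\<in>B. \<alpha> \<bullet> \<beta> = 0))"

text \<open>A positive system consists of the roots on one side of a hyperplane that contains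
  no root.\<close>

definition positive_system :: "'a::euclidean_space set \<Rightarrow> 'a set \<Rightarrow> bool"
  where "positive_system \<Phi> \<Phi>p \<longleftrightarrow>
    (\<exists>v. (\<forall>\<alpha>\<in>\<Phi>. \<alpha> \<bullet> v \<noteq> 0) \<and> \<Phi>p = {\<alpha> \<in> \<Phi>. \<alpha> \<bullet> v > 0})"

definition chamber :: "'a::euclidean_space set \<Rightarrow> 'a set"
  where "chamber \<Phi>p = {x. \<forall>\<alpha>\<in>\<Phi>p. \<alpha> \<bullet> x > 0}"

definition alcove :: "'a::euclidean_space set \<Rightarrow> 'a set"
  where "alcove \<Phi>p = {x. \<forall>\<alpha>\<in>\<Phi>p. 0 < x \<bullet> \<alpha> \<and> x \<bullet> \<alpha> < 1}"

definition weights :: "'a::euclidean_space set \<Rightarrow> 'a set"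
  where "weights \<Phi> = {x. \<forall>\<alpha>\<in>\<Phi>. coroot \<alpha> \<bullet> x \<in> \<int>}"

text \<open>The group of transformations generated by the reflections in the roots.\<close>

inductive_set weyl_group :: "'a::euclidean_space set \<Rightarrow> ('a \<Rightarrow> 'a) set"
  for \<Phi> :: "'a set"
  where
    weyl_id: "id \<in> weyl_group \<Phi>"
  | weyl_reflection: "\<alpha> \<in> \<Phi> \<Longrightarrow> root_reflection \<alpha> \<in> weyl_group \<Phi>"
  | weyl_comp: "v \<in> weyl_group \<Phi> \<Longrightarrow> w \<in> weyl_group \<Phi> \<Longrightarrow> v \<circ> w \<in> weyl_group \<Phi>"
  | weyl_inv: "w \<in> weyl_group \<Phi> \<Longrightarrow> inv w \<in> weyl_group \<Phi>"

text \<open>The library has determinants of matrices only. For an endomorphism \<open>f\<close> of an abstract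
  Euclidean space, this is the Leibniz formula for the matrix \<open>(b \<bullet> f c)\<close> of \<open>f\<close>
  in the orthonormal basis \<open>Basis\<close>; see \<open>lin_det_eq_det_matrix\<close> below.\<close>

definition lin_det :: "('a::euclidean_space \<Rightarrow> 'a) \<Rightarrow> real"
  where "lin_det f =
    (\<Sum>\<pi> | \<pi> permutes (Basis :: 'a set). of_int (sign \<pi>) * (\<Prod>b\<in>Basis. b \<bullet> f (\<pi> b)))"

lemma lin_det_eq_det_matrix:
  fixes f :: "real ^ 'n \<Rightarrow> real ^ 'n"
  shows "lin_det f = det (matrix f)"
proof -
  define e :: "'n \<Rightarrow> real ^ 'n" where "e = (\<lambda>i. axis i 1)"
  have inj: "inj e"
    by (auto simp: e_def inj_on_def axis_eq_axis)
  have bij: "bij_betw e UNIV Basis"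
    using inj by (auto simp: bij_betw_def e_def Basis_vec_def)
  have summand: "of_int (sign (map_permutation UNIV e \<pi>)) *
        (\<Prod>b\<in>Basis. b \<bullet> f (map_permutation UNIV e \<pi> b)) =
      of_int (sign \<pi>) * (\<Prod>i\<in>UNIV. matrix f $ i $ \<pi> i)" if "\<pi> permutes UNIV" for \<pi>
  proof -
    have "(\<Prod>b\<in>Basis. b \<bullet> f (map_permutation UNIV e \<pi> b)) =
        (\<Prod>i\<in>UNIV. e i \<bullet> f (map_permutation UNIV e \<pi> (e i)))"
      by (rule prod.reindex_bij_betw[OF bij, symmetric])
    also have "\<dots> = (\<Prod>i\<in>UNIV. matrix f $ i $ \<pi> i)"
      unfolding map_permutation_apply[OF inj UNIV_I]
      by (simp add: matrix_def e_def inner_axis')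
    finally show ?thesis
      by (simp add: sign_map_permutation inj that)
  qed
  have "lin_det f = (\<Sum>\<pi> | \<pi> permutes UNIV. of_int (sign (map_permutation UNIV e \<pi>)) *
      (\<Prod>b\<in>Basis. b \<bullet> f (map_permutation UNIV e \<pi> b)))"
    unfolding lin_det_def
  proof (rule sum.reindex_bij_betw[symmetric])
    have "e ` UNIV = Basis"
      using bij by (simp add: bij_betw_def)
    then have "map_permutation UNIV e =
        (\<lambda>\<pi> x. if x \<in> Basis then e (\<pi> (inv_into UNIV e x)) else x)"
      by (simp add: fun_eq_iff map_permutation_def restrict_id_def)
    then show "bij_betw (map_permutation UNIV e) {\<pi>. \<pi> permutes UNIV} {\<pi>. \<pi> permutes Basis}"
      using bij_betw_permutations[OF bij] by simp
  qed
  also have "\<dots> = det (matrix f)"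
    unfolding det_def by (intro sum.cong refl summand) auto
  finally show ?thesis .
qed

definition dirichlet_f :: "'a::euclidean_space set \<Rightarrow> 'a \<Rightarrow> 'a \<Rightarrow> complex"
  where "dirichlet_f \<Phi> p x =
    (\<Sum>w\<in>weyl_group \<Phi>. of_real (lin_det w) * exp (2 * of_real pi * \<i> * of_real (x \<bullet> w p)))"

definition neumann_g :: "'a::euclidean_space set \<Rightarrow> 'a \<Rightarrow> 'a \<Rightarrow> complex"
  where "neumann_g \<Phi> p x =
    (\<Sum>w\<in>weyl_group \<Phi>. exp (2 * of_real pi * \<i> * of_real (x \<bullet> w p)))"

definition equal_up_to_factor_on :: "'a set \<Rightarrow> ('a \<Rightarrow> complex) \<Rightarrow> ('a \<Rightarrow> complex) \<Rightarrow> bool"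
  where "equal_up_to_factor_on S f g \<longleftrightarrow> (\<exists>c. c \<noteq> 0 \<and> (\<forall>x\<in>S. f x = c * g x))"

definition real_up_to_factor_on :: "'a set \<Rightarrow> ('a \<Rightarrow> complex) \<Rightarrow> bool"
  where "real_up_to_factor_on S f \<longleftrightarrow> (\<exists>c. c \<noteq> 0 \<and> (\<forall>x\<in>S. c * f x \<in> \<real>))"

end

theory Submission
  imports Defs
begin

text \<open>A Weyl sum is a combination of the exponentials \<open>x \<mapsto> exp (2\<pi>i\<langle>x, q\<rangle>)\<close> with \<open>q\<close> in the
  orbit of \<open>p\<close>, and conjugation replaces \<open>q\<close> by \<open>- q\<close>. Exponentials with distinct frequencies
  are linearly independent on every nonempty open set, so if \<open>c f\<close> is real on the alcove, then
  the frequency \<open>p\<close>, which occurs in \<open>c f\<close>, also occurs in its conjugate, i.e. \<open>p\<close> lies in the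
  orbit of \<open>- p\<close>. For \<open>f\<^sub>p\<close> one has to know that the terms \<open>w p = p\<close> do not cancel: the polynomial
  \<open>\<Prod>\<alpha>\<in>\<Phi>\<^sup>+. \<langle>\<alpha>, x\<rangle>\<close> is multiplied by \<open>\<epsilon>(w)\<close> under \<open>w\<close> and does not vanish on the chamber, so
  \<open>\<epsilon>(w) = 1\<close> whenever \<open>w\<close> fixes \<open>p\<close>. Conversely, if \<open>w\<^sub>1 p = - p\<close>, then substituting \<open>w w\<^sub>1\<close> for
  \<open>w\<close> shows that the conjugate of \<open>f\<close> is \<open>\<epsilon>(w\<^sub>1) f\<close>.\<close>

section \<open>Determinants of endomorphisms\<close>

text \<open>A permutation other than the identity moves some basis vector, and the factor there is
  an off-diagonal entry. Hence only the identity contributes to the Leibniz sum.\<close>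

lemma lin_det_diagonal:
  fixes f :: "'a::euclidean_space \<Rightarrow> 'a"
  assumes "\<And>b c. b \<in> Basis \<Longrightarrow> c \<in> Basis \<Longrightarrow> b \<noteq> c \<Longrightarrow> b \<bullet> f c = 0"
  shows "lin_det f = (\<Prod>b\<in>Basis. b \<bullet> f b)"
proof -
  have "(\<Prod>b\<in>Basis. b \<bullet> f (\<pi> b)) = 0" if \<pi>: "\<pi> permutes (Basis :: 'a set)" "\<pi> \<noteq> id" for \<pi>
  proof -
    obtain b where b: "\<pi> b \<noteq> b" using \<pi>(2) by (auto simp: fun_eq_iff)
    then have "b \<in> Basis" using \<pi>(1) by (meson permutes_not_in)
    then have "\<pi> b \<in> Basis" using \<pi>(1) by (simp add: permutes_in_image)
    with b \<open>b \<in> Basis\<close> have "b \<bullet> f (\<pi> b) = 0" using assms by metis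
    with \<open>b \<in> Basis\<close> show ?thesis by (intro prod_zero) auto
  qed
  then have "lin_det f = (\<Sum>\<pi>\<in>{id}. of_int (sign \<pi>) * (\<Prod>b\<in>Basis. b \<bullet> f (\<pi> b)))"
    unfolding lin_det_def
    by (intro sum.mono_neutral_right) (auto simp: permutes_id finite_permutations)
  then show ?thesis by (simp add: sign_id)
qed

lemma lin_det_id: "lin_det (id :: 'a::euclidean_space \<Rightarrow> 'a) = 1"
  by (subst lin_det_diagonal) (auto simp: inner_not_same_Basis)

text \<open>This is the effect of a row permutation on a determinant. Replacing \<pi> by
  \<open>\<pi> \<circ> \<sigma>\<close> and reindexing the product along \<sigma> leaves only the
  factor \<open>sign \<sigma>\<close>.\<close>

lemma alternating_sum_permutation:
  fixes G :: "'b \<Rightarrow> 'b \<Rightarrow> real"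
  assumes "finite B" and "\<sigma> permutes B"
  shows "(\<Sum>\<pi> | \<pi> permutes B. of_int (sign \<pi>) * (\<Prod>b\<in>B. G (\<sigma> b) (\<pi> b))) =
    of_int (sign \<sigma>) * (\<Sum>\<pi> | \<pi> permutes B. of_int (sign \<pi>) * (\<Prod>b\<in>B. G b (\<pi> b)))"
proof -
  have perm: "permutation \<pi>" if "\<pi> permutes B" for \<pi>
    using that assms(1) permutes_imp_permutation by blast
  have "(\<Sum>\<pi> | \<pi> permutes B. of_int (sign \<pi>) * (\<Prod>b\<in>B. G (\<sigma> b) (\<pi> b))) =
      (\<Sum>\<pi> | \<pi> permutes B. of_int (sign (\<pi> \<circ> \<sigma>)) * (\<Prod>b\<in>B. G (\<sigma> b) ((\<pi> \<circ> \<sigma>) b)))"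
    by (rule sum_permutations_compose_right[OF assms(2)])
  also have "\<dots> = (\<Sum>\<pi> | \<pi> permutes B. of_int (sign \<sigma>) *
      (of_int (sign \<pi>) * (\<Prod>b\<in>B. G b (\<pi> b))))"
  proof (rule sum.cong)
    fix \<pi> assume "\<pi> \<in> {\<pi>. \<pi> permutes B}"
    moreover have "(\<Prod>b\<in>B. G (\<sigma> b) ((\<pi> \<circ> \<sigma>) b)) = (\<Prod>b\<in>B. G b (\<pi> b))"
      using prod.reindex_bij_betw[OF permutes_imp_bij[OF assms(2)], of "\<lambda>b. G b (\<pi> b)"] by simp
    ultimately show "of_int (sign (\<pi> \<circ> \<sigma>)) * (\<Prod>b\<in>B. G (\<sigma> b) ((\<pi> \<circ> \<sigma>) b)) =
        of_int (sign \<sigma>) * (of_int (sign \<pi>) * (\<Prod>b\<in>B. G b (\<pi> b)))"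
      using perm assms(2) by (simp add: sign_compose)
  qed simp
  finally show ?thesis by (simp add: sum_distrib_left)
qed

text \<open>The array has two equal rows, \<open>b\<close> and \<open>c\<close>. Exchanging them
  changes nothing, yet multiplies the sum by -1, so the sum vanishes.\<close>

lemma alternating_sum_not_inj:
  fixes G :: "'b \<Rightarrow> 'b \<Rightarrow> real"
  assumes "finite B" and "\<not> inj_on \<phi> B"
  shows "(\<Sum>\<pi> | \<pi> permutes B. of_int (sign \<pi>) * (\<Prod>b\<in>B. G (\<phi> b) (\<pi> b))) = 0"
proof -
  obtain b c where bc: "b \<in> B" "c \<in> B" "b \<noteq> c" "\<phi> b = \<phi> c"
    using assms(2) by (auto simp: inj_on_def)
  define \<tau> where "\<tau> = Transposition.transpose b c"
  have \<tau>: "\<tau> permutes B" unfolding \<tau>_def using bc by (simp add: permutes_swap_id)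
  have "\<phi> (\<tau> x) = \<phi> x" for x
    using bc by (auto simp: \<tau>_def Transposition.transpose_def)
  then have "(\<Sum>\<pi> | \<pi> permutes B. of_int (sign \<pi>) * (\<Prod>x\<in>B. G (\<phi> x) (\<pi> x))) =
      (\<Sum>\<pi> | \<pi> permutes B. of_int (sign \<pi>) * (\<Prod>x\<in>B. G (\<phi> (\<tau> x)) (\<pi> x)))"
    by simp
  also have "\<dots> = of_int (sign \<tau>) *
      (\<Sum>\<pi> | \<pi> permutes B. of_int (sign \<pi>) * (\<Prod>x\<in>B. G (\<phi> x) (\<pi> x)))"
    by (rule alternating_sum_permutation[OF assms(1) \<tau>])
  finally show ?thesis
    using bc by (simp add: \<tau>_def sign_swap_id)
qed

text \<open>Expanding the product leaves a sum over all maps \<open>\<phi>\<close> of the basis to itself,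
  in which only the injective ones, i.e. the permutations, survive.\<close>

lemma lin_det_comp:
  fixes f g :: "'a::euclidean_space \<Rightarrow> 'a"
  assumes "linear f"
  shows "lin_det (f \<circ> g) = lin_det f * lin_det g"
proof -
  let ?B = "Basis :: 'a set" and ?P = "{\<pi>. \<pi> permutes (Basis :: 'a set)}"
  \<comment> \<open>\<open>D \<phi>\<close> is the determinant of the matrix whose row
    \<open>b\<close> is row \<open>\<phi> b\<close> of the matrix of \<open>g\<close>.\<close>
  define D where "D \<phi> = (\<Sum>\<pi>\<in>?P. of_int (sign \<pi>) * (\<Prod>b\<in>?B. \<phi> b \<bullet> g (\<pi> b)))" for \<phi>
  have expand: "b \<bullet> f x = (\<Sum>c\<in>?B. (b \<bullet> f c) * (c \<bullet> x))" for b x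
  proof -
    have "f x = (\<Sum>c\<in>?B. (x \<bullet> c) *\<^sub>R f c)"
      by (subst euclidean_representation[symmetric, of x])
        (simp add: linear_sum[OF assms] linear_cmul[OF assms])
    then show ?thesis
      by (simp add: inner_sum_right inner_commute mult.commute)
  qed
  have "lin_det (f \<circ> g) = (\<Sum>\<pi>\<in>?P. \<Sum>\<phi>\<in>?B \<rightarrow>\<^sub>E ?B.
      of_int (sign \<pi>) * ((\<Prod>b\<in>?B. b \<bullet> f (\<phi> b)) * (\<Prod>b\<in>?B. \<phi> b \<bullet> g (\<pi> b))))"
  proof -
    have "(\<Prod>b\<in>?B. b \<bullet> f (g (\<pi> b))) =
        (\<Sum>\<phi>\<in>?B \<rightarrow>\<^sub>E ?B. (\<Prod>b\<in>?B. b \<bullet> f (\<phi> b)) * (\<Prod>b\<in>?B. \<phi> b \<bullet> g (\<pi> b)))" for \<pi>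
      by (subst expand) (simp add: prod_sum_PiE prod.distrib)
    then show ?thesis by (simp add: lin_det_def sum_distrib_left)
  qed
  also have "\<dots> = (\<Sum>\<phi>\<in>?B \<rightarrow>\<^sub>E ?B. (\<Prod>b\<in>?B. b \<bullet> f (\<phi> b)) * D \<phi>)"
    unfolding D_def sum_distrib_left
    by (subst sum.swap) (simp add: mult_ac)
  also have "\<dots> = (\<Sum>\<phi> | \<phi> \<in> ?B \<rightarrow>\<^sub>E ?B \<and> inj_on \<phi> ?B. (\<Prod>b\<in>?B. b \<bullet> f (\<phi> b)) * D \<phi>)"
    using alternating_sum_not_inj[of ?B _ "\<lambda>b c. b \<bullet> g c"]
    by (intro sum.mono_neutral_right) (auto simp: D_def finite_PiE)
  also have "\<dots> = (\<Sum>\<sigma>\<in>?P. (\<Prod>b\<in>?B. b \<bullet> f (\<sigma> b)) * D \<sigma>)"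
  \<comment> \<open>The two kinds of maps differ only outside the basis: elements of the function
    space are \<open>undefined\<close> there, permutations are the identity.\<close>
  proof (rule sum.reindex_bij_witness[of _ "\<lambda>\<sigma>. restrict \<sigma> ?B" "\<lambda>\<phi> x. if x \<in> ?B then \<phi> x else x"])
    fix \<phi> assume \<phi>: "\<phi> \<in> {\<phi>. \<phi> \<in> ?B \<rightarrow>\<^sub>E ?B \<and> inj_on \<phi> ?B}"
    then show "restrict (\<lambda>x. if x \<in> ?B then \<phi> x else x) ?B = \<phi>"
      by (auto simp: fun_eq_iff PiE_def extensional_def)
    have "\<phi> ` ?B = ?B"
      using \<phi> by (intro card_subset_eq) (auto simp: card_image)
    then have "bij_betw (\<lambda>x. if x \<in> ?B then \<phi> x else x) ?B ?B"
      using \<phi> by (auto simp: bij_betw_def inj_on_def)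
    then show "(\<lambda>x. if x \<in> ?B then \<phi> x else x) \<in> ?P"
      by (auto intro!: bij_imp_permutes)
    show "(\<Prod>b\<in>?B. b \<bullet> f (if b \<in> ?B then \<phi> b else b)) * D (\<lambda>x. if x \<in> ?B then \<phi> x else x) =
        (\<Prod>b\<in>?B. b \<bullet> f (\<phi> b)) * D \<phi>"
      by (simp add: D_def)
  next
    fix \<sigma> assume \<sigma>: "\<sigma> \<in> ?P"
    then show "(\<lambda>x. if x \<in> ?B then restrict \<sigma> ?B x else x) = \<sigma>"
      by (auto simp: fun_eq_iff permutes_not_in)
    show "restrict \<sigma> ?B \<in> {\<phi>. \<phi> \<in> ?B \<rightarrow>\<^sub>E ?B \<and> inj_on \<phi> ?B}"
      using \<sigma> by (auto simp: permutes_in_image intro: permutes_inj_on)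
  qed
  also have "\<dots> = (\<Sum>\<sigma>\<in>?P. of_int (sign \<sigma>) * (\<Prod>b\<in>?B. b \<bullet> f (\<sigma> b)) * lin_det g)"
    using alternating_sum_permutation[of ?B _ "\<lambda>b c. b \<bullet> g c"]
    by (intro sum.cong) (auto simp: D_def lin_det_def)
  also have "\<dots> = lin_det f * lin_det g"
    by (simp add: lin_det_def sum_distrib_right)
  finally show ?thesis .
qed

section \<open>Reflections and the Weyl group\<close>

lemma linear_root_reflection: "linear (root_reflection \<alpha>)"
  by (rule linearI)
    (simp_all add: root_reflection_def inner_add_right scaleR_add_left scaleR_diff_right)

lemma coroot_inner_self: "\<alpha> \<noteq> 0 \<Longrightarrow> coroot \<alpha> \<bullet> \<alpha> = 2"
  by (simp add: coroot_def)

lemma root_reflection_self: "\<alpha> \<noteq> 0 \<Longrightarrow> root_reflection \<alpha> \<alpha> = - \<alpha>"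
  by (simp add: root_reflection_def coroot_inner_self scaleR_2)

lemma root_reflection_involution: "root_reflection \<alpha> (root_reflection \<alpha> x) = x"
  by (cases "\<alpha> = 0")
    (simp_all add: root_reflection_def inner_diff_right coroot_inner_self)

lemma root_reflection_adjoint: "root_reflection \<alpha> x \<bullet> y = x \<bullet> root_reflection \<alpha> y"
  by (simp add: root_reflection_def coroot_def inner_diff_left inner_diff_right inner_commute)

lemma root_reflection_scaleR:
  "c \<noteq> 0 \<Longrightarrow> root_reflection (c *\<^sub>R \<alpha>) = root_reflection \<alpha>"
  by (simp add: fun_eq_iff root_reflection_def coroot_def)

text \<open>For vectors of equal norm, \<open>2 * ((a - b) \<bullet> a)\<close> is the squared norm
  of \<open>a - b\<close>, so the reflection subtracts \<open>a - b\<close> from \<open>a\<close>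
  exactly once.\<close>

lemma root_reflection_diff:
  assumes "norm a = norm b" and "a \<noteq> b"
  shows "root_reflection (a - b) a = b"
proof -
  have "2 * ((a - b) \<bullet> a) = (a - b) \<bullet> (a - b)"
    using assms(1) by (simp add: norm_eq inner_diff_left inner_diff_right inner_commute)
  then have "coroot (a - b) \<bullet> a = 1"
    using assms(2) by (simp add: coroot_def)
  then show ?thesis
    by (simp add: root_reflection_def)
qed

text \<open>The reflection in \<open>a - e\<close> exchanges unit vectors \<open>a\<close> and \<open>e\<close>, so it conjugates the reflection
  in \<open>a\<close> to that in a basis vector \<open>e\<close>, whose matrix is diagonal.\<close>

lemma lin_det_root_reflection:
  fixes \<alpha> :: "'a::euclidean_space"
  assumes "\<alpha> \<noteq> 0"
  shows "lin_det (root_reflection \<alpha>) = - 1"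
proof -
  have basis: "lin_det (root_reflection e) = - 1" if e: "e \<in> Basis" for e :: 'a
  proof -
    have "lin_det (root_reflection e) = (\<Prod>b\<in>Basis. b \<bullet> root_reflection e b)"
      by (rule lin_det_diagonal)
        (use e in \<open>auto simp: root_reflection_def coroot_def inner_diff_right inner_Basis\<close>)
    also have "\<dots> = (\<Prod>b\<in>Basis. if b = e then - 1 else 1)"
      by (rule prod.cong)
        (use e in \<open>auto simp: root_reflection_def coroot_def inner_diff_right inner_Basis\<close>)
    finally show ?thesis
      using e by simp
  qed
  obtain e :: 'a where e: "e \<in> Basis"
    using nonempty_Basis by blast
  define a where "a = (1 / norm \<alpha>) *\<^sub>R \<alpha>"
  have a: "root_reflection \<alpha> = root_reflection a"
    using assms by (simp add: a_def root_reflection_scaleR)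
  have norm_a: "norm a = norm e"
    using assms e by (simp add: a_def)
  show ?thesis
  proof (cases "a = e")
    case True
    then show ?thesis using basis e a by simp
  next
    case False
    define r where "r = root_reflection (a - e)"
    have r: "linear r" "\<And>x. r (r x) = x" "\<And>x y. r x \<bullet> y = x \<bullet> r y"
      by (simp_all add: r_def linear_root_reflection root_reflection_involution
          root_reflection_adjoint)
    have "r a = e"
      unfolding r_def using norm_a False by (rule root_reflection_diff)
    then have "r e = a"
      using r(2) by metis
    have "root_reflection a = r \<circ> (root_reflection e \<circ> r)"
    proof
      fix x
      have aa: "a \<bullet> a = e \<bullet> e"
        using norm_a by (simp add: norm_eq)
      \<comment> \<open>Self-adjointness of \<open>r\<close> together with \<open>r e = a\<close>
        gives \<open>e \<bullet> r x = a \<bullet> x\<close>; the normalizing factors agree because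
        the norms do.\<close>
      have "coroot a \<bullet> x = coroot e \<bullet> r x"
        using r(3)[of e x] \<open>r e = a\<close> aa by (simp add: coroot_def)
      then show "root_reflection a x = (r \<circ> (root_reflection e \<circ> r)) x"
        by (simp add: root_reflection_def linear_diff[OF r(1)] linear_cmul[OF r(1)] r(2) \<open>r e = a\<close>)
    qed
    then have "lin_det (root_reflection a) = lin_det r * lin_det r * lin_det (root_reflection e)"
      by (simp add: lin_det_comp r(1) linear_root_reflection)
    \<comment> \<open>Only the square of \<open>lin_det r\<close> enters, and it is known because
      \<open>r\<close> is an involution. The sign of \<open>r\<close>, itself a reflection, is not
      presupposed.\<close>
    moreover have "lin_det r * lin_det r = 1"
    proof -
      have "r \<circ> r = id" using r(2) by auto
      then show ?thesis
        using lin_det_comp[OF r(1), of r] by (simp add: lin_det_id)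
    qed
    ultimately show ?thesis
      using basis[OF e] a by simp
  qed
qed

section \<open>The Weyl group as a finite group of linear bijections\<close>

text \<open>The operator \<open>inv\<close> yields a genuine inverse only for bijections, so this
  precedes every statement whose induction passes through inverses.\<close>

lemma weyl_group_bij: "w \<in> weyl_group \<Phi> \<Longrightarrow> bij w"
proof (induction rule: weyl_group.induct)
  case (weyl_reflection \<alpha>)
  show ?case
    by (rule involuntory_imp_bij) (rule root_reflection_involution)
qed (simp_all add: bij_comp bij_imp_bij_inv del: id_apply comp_apply)

lemma weyl_group_linear: "w \<in> weyl_group \<Phi> \<Longrightarrow> linear w"
proof (induction rule: weyl_group.induct)
  case (weyl_inv w)
  then show ?case
    using weyl_group_bij by (intro inj_linear_imp_inv_linear) (auto simp: bij_def)
qed (simp_all add: linear_id linear_root_reflection linear_compose del: id_apply comp_apply)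

lemma weyl_group_image_roots:
  assumes "root_system \<Phi>" and "w \<in> weyl_group \<Phi>"
  shows "w ` \<Phi> = \<Phi>"
  using assms(2)
proof (induction rule: weyl_group.induct)
  case (weyl_reflection \<alpha>)
  then show ?case
    using assms(1) by (simp add: root_system_def)
next
  case (weyl_comp v w)
  then show ?case by (metis image_comp)
next
  case (weyl_inv w)
  then show ?case
    using weyl_group_bij[OF weyl_inv(1)] by (metis bij_def image_inv_f_f)
qed simp

text \<open>The roots span the space, so an element is determined by its restriction to the roots,
  and this is a map from a finite set to itself.\<close>

lemma finite_weyl_group:
  assumes "root_system \<Phi>"
  shows "finite (weyl_group \<Phi>)"
proof -
  have fin: "finite \<Phi>" and span: "span \<Phi> = UNIV"
    using assms by (auto simp: root_system_def)
  have "inj_on (\<lambda>w. restrict w \<Phi>) (weyl_group \<Phi>)"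
  proof (rule inj_onI)
    fix v w
    assume vw: "v \<in> weyl_group \<Phi>" "w \<in> weyl_group \<Phi>" and eq: "restrict v \<Phi> = restrict w \<Phi>"
    have "v x = w x" for x
    proof (rule linear_eq_on_span[of v w \<Phi>])
      show "linear v" "linear w" using vw by (auto intro: weyl_group_linear)
      show "\<And>x. x \<in> \<Phi> \<Longrightarrow> v x = w x" using eq by (metis restrict_apply')
    qed (simp add: span)
    then show "v = w" by blast
  qed
  moreover have "(\<lambda>w. restrict w \<Phi>) ` weyl_group \<Phi> \<subseteq> \<Phi> \<rightarrow>\<^sub>E \<Phi>"
    using weyl_group_image_roots[OF assms] by fastforce
  ultimately show ?thesis
    using finite_PiE[OF fin, of "\<lambda>_. \<Phi>"] fin by (meson finite_imageD finite_subset)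
qed

lemma weyl_group_lin_det_inv:
  assumes "w \<in> weyl_group \<Phi>"
  shows "lin_det w * lin_det (inv w) = 1"
proof -
  have "w \<circ> inv w = id"
    using weyl_group_bij[OF assms] by (simp add: bij_is_surj surj_iff[symmetric])
  then show ?thesis
    by (metis lin_det_comp lin_det_id weyl_group_linear[OF assms])
qed

text \<open>Reflections have determinant -1. In the squared form, the claim that the determinant is
  1 or -1 passes to products and inverses by multiplicativity alone.\<close>

lemma weyl_group_lin_det_square:
  assumes "root_system \<Phi>" and "w \<in> weyl_group \<Phi>"
  shows "lin_det w * lin_det w = 1"
  using assms(2)
proof (induction rule: weyl_group.induct)
  case (weyl_reflection \<alpha>)
  then have "\<alpha> \<noteq> 0" using assms(1) by (auto simp: root_system_def)
  then show ?case by (simp add: lin_det_root_reflection)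
next
  case (weyl_comp v w)
  have "lin_det (v \<circ> w) = lin_det v * lin_det w"
    using weyl_comp(1) by (simp add: lin_det_comp weyl_group_linear)
  then have "lin_det (v \<circ> w) * lin_det (v \<circ> w) = (lin_det v * lin_det v) * (lin_det w * lin_det w)"
    by (simp only: mult_ac)
  then show ?case by (simp only: weyl_comp.IH mult_1)
next
  case (weyl_inv w)
  have "(lin_det w * lin_det w) * (lin_det (inv w) * lin_det (inv w)) = 1"
    using weyl_group_lin_det_inv[OF weyl_inv(1)]
    by (metis mult.assoc mult.left_commute mult_1)
  then show ?case using weyl_inv.IH by simp
qed (simp add: lin_det_id del: id_apply)

section \<open>The product of the positive roots and the sign character\<close>

text \<open>Removing a pair \<open>x\<close>, \<open>f x\<close> of distinct elements leaves a
  smaller set on which \<open>f\<close> is still an involution without fixed points.\<close>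

lemma even_card_involution:
  assumes "finite A" and "\<And>x. x \<in> A \<Longrightarrow> f x \<in> A \<and> f (f x) = x \<and> f x \<noteq> x"
  shows "even (card A)"
  using assms
proof (induction A rule: finite_psubset_induct)
  case (psubset A)
  show ?case
  proof (cases "A = {}")
    case False
    then obtain x where x: "x \<in> A" by blast
    define B where "B = A - {x, f x}"
    have A: "A = insert x (insert (f x) B)"
      using x psubset.prems[OF x] by (auto simp: B_def)
    have "even (card B)"
    proof (rule psubset.IH)
      show "B \<subset> A" using x by (auto simp: B_def)
      fix y assume y: "y \<in> B"
      then have "y \<in> A" "y \<noteq> x" "y \<noteq> f x" by (auto simp: B_def)
      then show "f y \<in> B \<and> f (f y) = y \<and> f y \<noteq> y"
        using psubset.prems[of y] psubset.prems[OF x] by (auto simp: B_def)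
    qed
    moreover have "card A = card B + 2"
    proof -
      have "x \<notin> insert (f x) B" "f x \<notin> B" "finite B"
        using psubset.prems[OF x] psubset.hyps by (auto simp: B_def)
      then show ?thesis by (simp add: A)
    qed
    ultimately show ?thesis by simp
  qed simp
qed

text \<open>The reflection in a positive root \<open>\<beta>\<close> permutes the positive roots that it keeps positive.
  On those that it makes negative, \<open>\<alpha> \<mapsto> - s\<^sub>\<beta> \<alpha>\<close> is an involution with the single fixed point
  \<open>\<beta>\<close>, so their number is odd.\<close>

lemma prod_positive_roots_reflection:
  assumes "root_system \<Phi>" and "positive_system \<Phi> P" and "\<beta> \<in> \<Phi>"
  shows "(\<Prod>\<alpha>\<in>P. \<alpha> \<bullet> root_reflection \<beta> x) = - (\<Prod>\<alpha>\<in>P. \<alpha> \<bullet> x)"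
proof -
  have fin: "finite \<Phi>" and red: "\<And>\<alpha>. \<alpha> \<in> \<Phi> \<Longrightarrow> \<Phi> \<inter> span {\<alpha>} = {\<alpha>, - \<alpha>}"
    and refl: "\<And>\<alpha>. \<alpha> \<in> \<Phi> \<Longrightarrow> root_reflection \<alpha> ` \<Phi> = \<Phi>" and "0 \<notin> \<Phi>"
    using assms(1) by (auto simp: root_system_def)
  obtain v where v: "\<And>\<alpha>. \<alpha> \<in> \<Phi> \<Longrightarrow> \<alpha> \<bullet> v \<noteq> 0" and P: "P = {\<alpha> \<in> \<Phi>. \<alpha> \<bullet> v > 0}"
    using assms(2) by (auto simp: positive_system_def)
  have neg: "- \<alpha> \<in> \<Phi>" if "\<alpha> \<in> \<Phi>" for \<alpha>
    using red[OF that] by blast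
  have pos: "- \<alpha> \<in> P \<longleftrightarrow> \<alpha> \<notin> P" if "\<alpha> \<in> \<Phi>" for \<alpha>
    using v[OF that] neg[OF that] that by (auto simp: P)
  have finP: "finite P" using fin by (simp add: P)
  have main: "(\<Prod>\<alpha>\<in>P. \<alpha> \<bullet> root_reflection \<beta> x) = - (\<Prod>\<alpha>\<in>P. \<alpha> \<bullet> x)" if \<beta>: "\<beta> \<in> P" for \<beta>
  proof -
    define s where "s = root_reflection \<beta>"
    have ss: "s (s y) = y" and s_neg: "s (- y) = - s y" for y
      by (simp_all add: s_def root_reflection_involution linear_neg[OF linear_root_reflection])
    have \<beta>\<Phi>: "\<beta> \<in> \<Phi>" using \<beta> by (simp add: P)
    have s\<Phi>: "s \<alpha> \<in> \<Phi>" if "\<alpha> \<in> P" for \<alpha>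
      using refl[OF \<beta>\<Phi>] that by (auto simp: s_def P)
    have s\<beta>: "s \<beta> = - \<beta>"
      using \<open>0 \<notin> \<Phi>\<close> \<beta>\<Phi> unfolding s_def by (intro root_reflection_self) auto
    define N where "N = {\<alpha> \<in> P. s \<alpha> \<notin> P}"
    define M where "M = {\<alpha> \<in> P. s \<alpha> \<in> P}"
    have NM: "P = M \<union> N" "M \<inter> N = {}" and fins: "finite N" "finite M"
      using finP by (auto simp: N_def M_def)
    have N_flip: "- s \<alpha> \<in> N" if "\<alpha> \<in> N" for \<alpha>
    proof -
      have "\<alpha> \<in> P" "s \<alpha> \<notin> P" using that by (auto simp: N_def)
      moreover have "\<alpha> \<in> \<Phi>" using \<open>\<alpha> \<in> P\<close> by (simp add: P)
      ultimately show ?thesis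
        using pos[OF s\<Phi>[OF \<open>\<alpha> \<in> P\<close>]] pos[of \<alpha>] by (simp add: N_def s_neg ss)
    qed
    have "\<beta> \<in> N"
      using \<beta> pos[OF \<beta>\<Phi>] by (simp add: N_def s\<beta>)
    have "even (card (N - {\<beta>}))"
    proof (rule even_card_involution[where f = "\<lambda>\<alpha>. - s \<alpha>"])
      fix \<alpha> assume \<alpha>: "\<alpha> \<in> N - {\<beta>}"
      have "- s \<alpha> \<noteq> \<beta>"
      proof
        assume "- s \<alpha> = \<beta>"
        then have "s (- s \<alpha>) = s \<beta>" by simp
        then show False using \<alpha> by (simp add: s_neg ss s\<beta>)
      qed
      \<comment> \<open>A fixed point would be a multiple of \<beta>, hence \<beta> or
        \<open>- \<beta>\<close> since the root system is reduced; the former was removed and the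
        latter is not positive.\<close>
      moreover have "- s \<alpha> \<noteq> \<alpha>"
      proof
        assume "- s \<alpha> = \<alpha>"
        then have "2 *\<^sub>R \<alpha> = (coroot \<beta> \<bullet> \<alpha>) *\<^sub>R \<beta>"
          by (simp add: s_def root_reflection_def scaleR_2 algebra_simps)
        then have "(1/2) *\<^sub>R (2 *\<^sub>R \<alpha>) = (1/2) *\<^sub>R ((coroot \<beta> \<bullet> \<alpha>) *\<^sub>R \<beta>)"
          by simp
        then have "\<alpha> = ((coroot \<beta> \<bullet> \<alpha>) / 2) *\<^sub>R \<beta>"
          by simp
        then have "\<alpha> \<in> span {\<beta>}"
          by (metis span_base span_mul insertI1)
        then have "\<alpha> = \<beta> \<or> \<alpha> = - \<beta>"
          using \<alpha> red[OF \<beta>\<Phi>] by (auto simp: N_def P)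
        then show False
          using \<alpha> \<beta> pos[OF \<beta>\<Phi>] by (auto simp: N_def)
      qed
      ultimately show "- s \<alpha> \<in> N - {\<beta>} \<and> - s (- s \<alpha>) = \<alpha> \<and> - s \<alpha> \<noteq> \<alpha>"
        using \<alpha> N_flip by (simp add: s_neg ss)
    qed (simp add: fins)
    moreover have "card N = Suc (card (N - {\<beta>}))"
      using \<open>\<beta> \<in> N\<close> fins by (metis card.remove)
    ultimately have odd: "odd (card N)" by simp
    \<comment> \<open>Self-adjointness moves \<open>s\<close> onto the roots. There \<open>s\<close>
      permutes \<open>M\<close> and maps \<open>N\<close> bijectively onto the negatives of
      \<open>N\<close>, which contributes the sign of an odd power of -1.\<close>
    have "(\<Prod>\<alpha>\<in>P. \<alpha> \<bullet> s x) = (\<Prod>\<alpha>\<in>P. s \<alpha> \<bullet> x)"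
      by (simp add: s_def root_reflection_adjoint)
    also have "\<dots> = (\<Prod>\<alpha>\<in>M. s \<alpha> \<bullet> x) * (\<Prod>\<alpha>\<in>N. s \<alpha> \<bullet> x)"
      using NM fins by (simp add: prod.union_disjoint)
    also have "(\<Prod>\<alpha>\<in>M. s \<alpha> \<bullet> x) = (\<Prod>\<alpha>\<in>M. \<alpha> \<bullet> x)"
      by (rule prod.reindex_bij_witness[of _ s s]) (auto simp: M_def ss)
    also have "(\<Prod>\<alpha>\<in>N. s \<alpha> \<bullet> x) = (\<Prod>\<alpha>\<in>N. - (\<alpha> \<bullet> x))"
      by (rule prod.reindex_bij_witness[of _ "\<lambda>\<alpha>. - s \<alpha>" "\<lambda>\<alpha>. - s \<alpha>"])
        (auto simp: N_flip s_neg ss)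
    also have "\<dots> = - (\<Prod>\<alpha>\<in>N. \<alpha> \<bullet> x)"
      using odd by (simp add: prod_uminus)
    also have "(\<Prod>\<alpha>\<in>M. \<alpha> \<bullet> x) * - (\<Prod>\<alpha>\<in>N. \<alpha> \<bullet> x) = - (\<Prod>\<alpha>\<in>P. \<alpha> \<bullet> x)"
      using NM fins by (simp add: prod.union_disjoint)
    finally show ?thesis by (simp add: s_def)
  qed
  show ?thesis
  proof (cases "\<beta> \<in> P")
    case True
    then show ?thesis by (rule main)
  next
    case False
    \<comment> \<open>Opposite roots define the same reflection, so the positive one of the two may
      be used.\<close>
    then have "- \<beta> \<in> P" using pos[OF assms(3)] by simp
    then show ?thesis
      using main[of "- \<beta>"] root_reflection_scaleR[of "-1" \<beta>] by simp
  qed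
qed

text \<open>Reflections contribute -1, and multiplicativity of \<open>lin_det\<close> does the rest.
  The point \<open>x\<close> is kept arbitrary because a composition uses the hypothesis on
  \<open>v\<close> at \<open>w x\<close>, and an inverse uses that on \<open>w\<close> at
  \<open>inv w x\<close>.\<close>

lemma prod_positive_roots_weyl:
  assumes "root_system \<Phi>" and "positive_system \<Phi> P" and "w \<in> weyl_group \<Phi>"
  shows "(\<Prod>\<alpha>\<in>P. \<alpha> \<bullet> w x) = lin_det w * (\<Prod>\<alpha>\<in>P. \<alpha> \<bullet> x)"
  using assms(3)
proof (induction arbitrary: x rule: weyl_group.induct)
  case (weyl_reflection \<alpha>)
  then have "\<alpha> \<noteq> 0" using assms(1) by (auto simp: root_system_def)
  then show ?case
    using prod_positive_roots_reflection[OF assms(1,2) weyl_reflection]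
    by (simp add: lin_det_root_reflection)
next
  case (weyl_comp v w)
  have "lin_det (v \<circ> w) = lin_det v * lin_det w"
    using weyl_comp(1) by (simp only: lin_det_comp weyl_group_linear)
  then show "(\<Prod>\<alpha>\<in>P. \<alpha> \<bullet> (v \<circ> w) x) = lin_det (v \<circ> w) * (\<Prod>\<alpha>\<in>P. \<alpha> \<bullet> x)"
    by (simp add: weyl_comp.IH)
next
  case (weyl_inv w)
  have winv: "w (inv w x) = x"
    using weyl_group_bij[OF weyl_inv(1)] by (simp add: bij_is_surj surj_f_inv_f)
  have "(\<Prod>\<alpha>\<in>P. \<alpha> \<bullet> x) = lin_det w * (\<Prod>\<alpha>\<in>P. \<alpha> \<bullet> inv w x)"
    using weyl_inv.IH[of "inv w x"] by (simp add: winv)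
  then have "lin_det (inv w) * (\<Prod>\<alpha>\<in>P. \<alpha> \<bullet> x) =
      (lin_det w * lin_det (inv w)) * (\<Prod>\<alpha>\<in>P. \<alpha> \<bullet> inv w x)"
    by simp
  then show ?case by (simp add: weyl_group_lin_det_inv[OF weyl_inv(1)])
qed (simp add: lin_det_id flip: id_def)

text \<open>All factors of the product are positive at \<open>p\<close>, so the product cancels from
  its transformation law at the fixed point \<open>p\<close>.\<close>

lemma lin_det_stabilizer_chamber:
  assumes "root_system \<Phi>" and "positive_system \<Phi> P" and "p \<in> chamber P"
    and "w \<in> weyl_group \<Phi>" and "w p = p"
  shows "lin_det w = 1"
proof -
  have "finite P"
    using assms(1,2) by (auto simp: root_system_def positive_system_def)
  then have "(\<Prod>\<alpha>\<in>P. \<alpha> \<bullet> p) \<noteq> 0"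
    using assms(3) by (force simp: chamber_def)
  then show ?thesis
    using prod_positive_roots_weyl[OF assms(1,2,4), of p] assms(5) by simp
qed

section \<open>Real exponential sums\<close>

definition wave :: "'a::euclidean_space \<Rightarrow> 'a \<Rightarrow> complex"
  where "wave q x = exp (2 * of_real pi * \<i> * of_real (x \<bullet> q))"

lemma wave_add: "wave q (x + y) = wave q x * wave q y"
  by (simp add: wave_def inner_add_left distrib_left exp_add)

lemma cnj_wave: "cnj (wave q x) = wave (- q) x"
  by (simp add: wave_def exp_cnj)

lemma wave_eq_cis: "wave q x = cis (2 * pi * (x \<bullet> q))"
  by (simp add: wave_def cis_conv_exp mult_ac)

lemma wave_separates:
  fixes p q :: "'a::euclidean_space"
  assumes "p \<noteq> q" and "r > 0"
  obtains y where "norm y < r" and "wave p y \<noteq> wave q y"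
proof -
  define d where "d = p - q"
  \<comment> \<open>The first bound keeps \<open>t *\<^sub>R d\<close> shorter than
    \<open>r\<close>. The second puts \<open>t * (d \<bullet> d)\<close>, the phase difference in
    full turns, strictly between 0 and 1, so the two waves differ.\<close>
  define t where "t = min (r / (2 * norm d)) (1 / (2 * (d \<bullet> d)))"
  have d: "norm d > 0" "d \<bullet> d > 0"
    using assms by (auto simp: d_def)
  have t: "t > 0" using d assms by (simp add: t_def)
  have "t \<le> r / (2 * norm d)" "t \<le> 1 / (2 * (d \<bullet> d))"
    by (simp_all add: t_def)
  then have small: "t * norm d < r" "t * (d \<bullet> d) < 1"
    using d assms(2) by (simp_all add: field_simps)
  have "wave p (t *\<^sub>R d) \<noteq> wave q (t *\<^sub>R d)"
  proof
    assume "wave p (t *\<^sub>R d) = wave q (t *\<^sub>R d)"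
    then obtain n :: int where
      "2 * of_real pi * \<i> * of_real ((t *\<^sub>R d) \<bullet> p) =
        2 * of_real pi * \<i> * of_real ((t *\<^sub>R d) \<bullet> q) + of_int (2 * n) * of_real pi * \<i>"
      unfolding wave_def exp_eq by auto
    then have "Im (2 * of_real pi * \<i> * of_real ((t *\<^sub>R d) \<bullet> p)) =
        Im (2 * of_real pi * \<i> * of_real ((t *\<^sub>R d) \<bullet> q) + of_int (2 * n) * of_real pi * \<i>)"
      by simp
    then have "2 * pi * (t * (d \<bullet> d)) = 2 * pi * of_int n"
      by (simp add: d_def inner_diff_right algebra_simps)
    then have "t * (d \<bullet> d) = of_int n" by simp
    moreover have "t * (d \<bullet> d) > 0" using t d by simp
    ultimately show False using small(2) by simp
  qed
  then show ?thesis
    using that[of "t *\<^sub>R d"] small(1) t by simp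
qed

text \<open>The frequencies \<open>k j\<close> may repeat among themselves; only \<open>p\<close> is
  isolated, so only its coefficient is shown to vanish. Coefficients and \<open>S\<close> vary in
  the induction: a translation changes the former by factors and shrinks the latter to the points
  where both relations hold, a set containing \<open>x0\<close> because the shift is short.\<close>

lemma wave_independent:
  fixes p :: "'a::euclidean_space"
  assumes "finite J" and "\<And>j. j \<in> J \<Longrightarrow> k j \<noteq> p" and "open S" and "S \<noteq> {}"
    and "\<And>x. x \<in> S \<Longrightarrow> A * wave p x + (\<Sum>j\<in>J. a j * wave (k j) x) = 0"
  shows "A = 0"
  using assms
proof (induction J arbitrary: A a S rule: finite_induct)
  case empty
  then show ?case by (auto simp: wave_def)
next
  case (insert i J)
  obtain x0 where x0: "x0 \<in> S" using insert.prems by blast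
  then obtain r where r: "r > 0" "ball x0 r \<subseteq> S"
    using insert.prems(2) openE by blast
  have "p \<noteq> k i" using insert.prems(1)[of i] by auto
  then obtain y where y: "norm y < r" "wave p y \<noteq> wave (k i) y"
    using wave_separates r(1) by blast
  \<comment> \<open>Subtracting \<open>wave (k i) y\<close> times the relation at \<open>x\<close> from the relation at \<open>x + y\<close>
    eliminates the term \<open>i\<close>.\<close>
  define T where "T = S \<inter> (\<lambda>x. x + y) -` S"
  have "A * (wave p y - wave (k i) y) = 0"
  proof (rule insert.IH)
    show "k j \<noteq> p" if "j \<in> J" for j
      using insert.prems(1) that by blast
    show "open T"
      unfolding T_def using insert.prems(2)
      by (intro open_Int open_vimage continuous_intros)
    show "T \<noteq> {}"
      using x0 r(2) y(1) by (auto simp: T_def dist_norm subset_iff)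
    fix x assume "x \<in> T"
    then have "x \<in> S" "x + y \<in> S" by (auto simp: T_def)
    have 1: "A * wave p x + a i * wave (k i) x + (\<Sum>j\<in>J. a j * wave (k j) x) = 0"
      using insert.prems(4)[OF \<open>x \<in> S\<close>] insert.hyps by (simp add: add.assoc)
    have 2: "A * (wave p x * wave p y) + a i * (wave (k i) x * wave (k i) y) +
        (\<Sum>j\<in>J. a j * (wave (k j) x * wave (k j) y)) = 0"
      using insert.prems(4)[OF \<open>x + y \<in> S\<close>] insert.hyps by (simp add: add.assoc wave_add)
    have "(\<Sum>j\<in>J. a j * (wave (k j) y - wave (k i) y) * wave (k j) x) =
        (\<Sum>j\<in>J. a j * (wave (k j) x * wave (k j) y)) - wave (k i) y * (\<Sum>j\<in>J. a j * wave (k j) x)"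
      by (simp add: sum_distrib_left sum_subtractf[symmetric] algebra_simps)
    moreover have "(\<Sum>j\<in>J. a j * (wave (k j) x * wave (k j) y)) =
        - (A * (wave p x * wave p y) + a i * (wave (k i) x * wave (k i) y))"
      by (rule minus_unique[OF 2, symmetric])
    moreover have "(\<Sum>j\<in>J. a j * wave (k j) x) = - (A * wave p x + a i * wave (k i) x)"
      by (rule minus_unique[OF 1, symmetric])
    ultimately show "A * (wave p y - wave (k i) y) * wave p x +
        (\<Sum>j\<in>J. a j * (wave (k j) y - wave (k i) y) * wave (k j) x) = 0"
      by (simp add: algebra_simps)
  qed
  then show ?case using y(2) by simp
qed

section \<open>The alcove as a nonempty open set\<close>

lemma open_alcove:
  assumes "finite P"
  shows "open (alcove P)"
proof -
  have "alcove P = (\<Inter>\<alpha>\<in>P. {x. 0 < x \<bullet> \<alpha>} \<inter> {x. x \<bullet> \<alpha> < 1})"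
    by (auto simp: alcove_def)
  then show ?thesis
    using assms by (auto intro!: open_INT open_Int open_Collect_less continuous_intros)
qed

lemma alcove_nonempty:
  assumes "finite \<Phi>" and "positive_system \<Phi> P"
  shows "alcove P \<noteq> {}"
proof -
  obtain v where P: "P = {\<alpha> \<in> \<Phi>. \<alpha> \<bullet> v > 0}"
    using assms(2) by (auto simp: positive_system_def)
  have fin: "finite P" using assms(1) by (simp add: P)
  \<comment> \<open>All the numbers \<open>\<alpha> \<bullet> v\<close> are positive, so their sum
    bounds each of them; the added 1 makes the bound strict and keeps \<open>m\<close> positive for
    an empty sum. Dividing \<open>v\<close> by \<open>m\<close> then gives a point of the
    alcove.\<close>
  define m where "m = 1 + (\<Sum>\<alpha>\<in>P. \<alpha> \<bullet> v)"
  have "\<alpha> \<bullet> v < m" if "\<alpha> \<in> P" for \<alpha>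
    using member_le_sum[of \<alpha> P "\<lambda>\<alpha>. \<alpha> \<bullet> v"] that fin by (force simp: m_def P)
  moreover have "m > 0"
    unfolding m_def by (intro add_pos_nonneg sum_nonneg) (auto simp: P)
  ultimately have "(1 / m) *\<^sub>R v \<in> alcove P"
    by (auto simp: alcove_def P inner_commute)
  then show ?thesis by blast
qed

section \<open>Weyl sums and their conjugates\<close>

text \<open>The coefficient function is a parameter so that \<open>lin_det\<close> and the constant
  1 give the Dirichlet and the Neumann case at once.\<close>

definition weyl_sum :: "('a::euclidean_space \<Rightarrow> 'a) set \<Rightarrow> (('a \<Rightarrow> 'a) \<Rightarrow> real) \<Rightarrow> 'a \<Rightarrow> 'a \<Rightarrow> complex"
  where "weyl_sum W \<epsilon> p x = (\<Sum>w\<in>W. of_real (\<epsilon> w) * wave (w p) x)"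

lemma cnj_weyl_sum: "cnj (weyl_sum W \<epsilon> p x) = (\<Sum>w\<in>W. of_real (\<epsilon> w) * wave (- w p) x)"
  by (simp add: weyl_sum_def cnj_wave)

lemma real_weyl_sum_imp_neg_in_orbit:
  fixes p :: "'a::euclidean_space"
  assumes "finite W" and "id \<in> W" and \<epsilon>: "\<And>w. w \<in> W \<Longrightarrow> w p = p \<Longrightarrow> \<epsilon> w = 1"
    and "open S" and "S \<noteq> {}" and "real_up_to_factor_on S (weyl_sum W \<epsilon> p)"
  shows "\<exists>w\<in>W. w p = - p"
proof (rule ccontr)
  assume neg: "\<not> ?thesis"
  obtain c where c: "c \<noteq> 0" "\<And>x. x \<in> S \<Longrightarrow> c * weyl_sum W \<epsilon> p x \<in> \<real>"
    using assms(6) by (auto simp: real_up_to_factor_on_def)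
  \<comment> \<open>The disjoint union keeps apart the terms of the sum whose frequency is not
    \<open>p\<close> and all terms of the conjugate sum. A frequency \<open>- w p\<close> of the
    latter equal to \<open>p\<close> would give \<open>w p = - p\<close>. Thus only the stabilizer
    \<open>H\<close> contributes at \<open>p\<close>, with total coefficient
    \<open>c * of_nat (card H)\<close>.\<close>
  define J where "J = {w \<in> W. w p \<noteq> p} <+> W"
  define k where "k = case_sum (\<lambda>w :: 'a \<Rightarrow> 'a. w p) (\<lambda>w :: 'a \<Rightarrow> 'a. - w p)"
  define a where "a = case_sum (\<lambda>w. c * of_real (\<epsilon> w)) (\<lambda>w. - cnj c * of_real (\<epsilon> w))"
  define H where "H = {w \<in> W. w p = p}"
  have "c * of_nat (card H) = 0"
  proof (rule wave_independent)
    show "finite J" using assms(1) by (simp add: J_def)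
    show "k j \<noteq> p" if "j \<in> J" for j
      using that neg by (auto simp: J_def k_def) (metis minus_minus)
    show "open S" "S \<noteq> {}" by fact+
    fix x assume "x \<in> S"
    have "weyl_sum W \<epsilon> p x = (\<Sum>w\<in>H. of_real (\<epsilon> w) * wave (w p) x) +
        (\<Sum>w | w \<in> W \<and> w p \<noteq> p. of_real (\<epsilon> w) * wave (w p) x)"
      unfolding weyl_sum_def H_def using assms(1)
      by (subst sum.union_disjoint[symmetric]) (auto intro!: sum.cong)
    also have "(\<Sum>w\<in>H. of_real (\<epsilon> w) * wave (w p) x) = of_nat (card H) * wave p x"
      by (simp add: H_def \<epsilon>)
    finally have split: "weyl_sum W \<epsilon> p x = of_nat (card H) * wave p x +
        (\<Sum>w | w \<in> W \<and> w p \<noteq> p. of_real (\<epsilon> w) * wave (w p) x)" .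
    have "cnj (c * weyl_sum W \<epsilon> p x) = c * weyl_sum W \<epsilon> p x"
      using c(2)[OF \<open>x \<in> S\<close>] by (simp add: Reals_cnj_iff)
    then have "c * weyl_sum W \<epsilon> p x - cnj c * cnj (weyl_sum W \<epsilon> p x) = 0"
      by simp
    then show "c * of_nat (card H) * wave p x + (\<Sum>j\<in>J. a j * wave (k j) x) = 0"
      unfolding cnj_weyl_sum unfolding split
      using assms(1)
      by (simp add: J_def k_def a_def sum.Plus sum_distrib_left sum_negf algebra_simps)
  qed
  moreover have "card H > 0"
    using assms(1,2) by (auto simp: H_def card_gt_0_iff)
  ultimately show False using c(1) by simp
qed

text \<open>Conjugation replaces the frequency \<open>w p\<close> by \<open>- w p\<close>, which is
  \<open>(w \<circ> v) p\<close>. Right translation by \<open>v\<close> permutes the group and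
  changes each coefficient by the factor \<open>\<epsilon> v\<close>, which is its own
  inverse.\<close>

lemma cnj_weyl_sum_neg_in_orbit:
  assumes comp: "\<And>v w. v \<in> weyl_group \<Phi> \<Longrightarrow> w \<in> weyl_group \<Phi> \<Longrightarrow> \<epsilon> (v \<circ> w) = \<epsilon> v * \<epsilon> w"
    and sq: "\<And>w. w \<in> weyl_group \<Phi> \<Longrightarrow> \<epsilon> w * \<epsilon> w = 1"
    and v: "v \<in> weyl_group \<Phi>" "v p = - p"
  shows "cnj (weyl_sum (weyl_group \<Phi>) \<epsilon> p x) = of_real (\<epsilon> v) * weyl_sum (weyl_group \<Phi>) \<epsilon> p x"
proof -
  let ?W = "weyl_group \<Phi>"
  have inv: "inv v \<circ> v = id" "v \<circ> inv v = id"
    using weyl_group_bij[OF v(1)] by (simp_all add: bij_is_inj bij_is_surj surj_iff[symmetric])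
  have "cnj (weyl_sum ?W \<epsilon> p x) = (\<Sum>w\<in>?W. of_real (\<epsilon> v) * (of_real (\<epsilon> (w \<circ> v)) * wave ((w \<circ> v) p) x))"
    unfolding cnj_weyl_sum
  proof (rule sum.cong)
    fix w assume w: "w \<in> ?W"
    have "- w p = (w \<circ> v) p"
      using linear_neg[OF weyl_group_linear[OF w], of p] v(2) by simp
    moreover have "\<epsilon> w = \<epsilon> v * \<epsilon> (w \<circ> v)"
      using comp[OF w v(1)] sq[OF v(1)] by (metis mult.assoc mult.commute mult_1)
    ultimately show "of_real (\<epsilon> w) * wave (- w p) x =
        of_real (\<epsilon> v) * (of_real (\<epsilon> (w \<circ> v)) * wave ((w \<circ> v) p) x)"
      by (metis mult.assoc of_real_mult)
  qed simp
  also have "\<dots> = of_real (\<epsilon> v) * (\<Sum>w\<in>?W. of_real (\<epsilon> (w \<circ> v)) * wave ((w \<circ> v) p) x)"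
    by (simp only: sum_distrib_left)
  also have "(\<Sum>w\<in>?W. of_real (\<epsilon> (w \<circ> v)) * wave ((w \<circ> v) p) x) = weyl_sum ?W \<epsilon> p x"
    unfolding weyl_sum_def
  proof (rule sum.reindex_bij_witness[of _ "\<lambda>w. w \<circ> inv v" "\<lambda>w. w \<circ> v"])
    fix w assume w: "w \<in> ?W"
    show "w \<circ> v \<circ> inv v = w" "w \<circ> inv v \<circ> v = w"
      by (simp_all only: comp_assoc inv comp_id)
    show "w \<circ> v \<in> ?W" "w \<circ> inv v \<in> ?W"
      using w v(1) by (auto intro: weyl_comp weyl_inv)
  qed (rule refl)
  finally show ?thesis .
qed

lemma Re_weyl_sum: "Re (weyl_sum W \<epsilon> p x) = (\<Sum>w\<in>W. \<epsilon> w * cos (2 * pi * (x \<bullet> w p)))"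
  by (simp add: weyl_sum_def wave_eq_cis)

lemma Im_weyl_sum: "Im (weyl_sum W \<epsilon> p x) = (\<Sum>w\<in>W. \<epsilon> w * sin (2 * pi * (x \<bullet> w p)))"
  by (simp add: weyl_sum_def wave_eq_cis)

text \<open>A number equal to its conjugate is its own real part.\<close>

lemma weyl_sum_eq_cos_sum:
  assumes "cnj (weyl_sum W \<epsilon> p x) = weyl_sum W \<epsilon> p x"
  shows "weyl_sum W \<epsilon> p x = of_real (\<Sum>w\<in>W. \<epsilon> w * cos (2 * pi * (x \<bullet> w p)))"
  using assms by (simp add: complex_eq_iff Re_weyl_sum)

text \<open>A number opposite to its conjugate is purely imaginary, which leaves the sine
  terms.\<close>

lemma weyl_sum_eq_sin_sum:
  assumes "cnj (weyl_sum W \<epsilon> p x) = - weyl_sum W \<epsilon> p x"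
  shows "weyl_sum W \<epsilon> p x = \<i> * of_real (\<Sum>w\<in>W. \<epsilon> w * sin (2 * pi * (x \<bullet> w p)))"
  using assms by (simp add: complex_eq_iff Im_weyl_sum)

section \<open>Dirichlet and Neumann eigenfunctions as Weyl sums\<close>

lemma dirichlet_f_eq_weyl_sum: "dirichlet_f \<Phi> = weyl_sum (weyl_group \<Phi>) lin_det"
  by (simp add: fun_eq_iff dirichlet_f_def weyl_sum_def wave_def)

lemma neumann_g_eq_weyl_sum: "neumann_g \<Phi> = weyl_sum (weyl_group \<Phi>) (\<lambda>_. 1)"
  by (simp add: fun_eq_iff neumann_g_def weyl_sum_def wave_def)

theorem proposition28:
  fixes \<Phi> \<Phi>p :: "'a::euclidean_space set"
  assumes "root_system \<Phi>" and "crystallographic \<Phi>" and "irreducible_roots \<Phi>"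
    and "positive_system \<Phi> \<Phi>p"
  shows "(\<forall>p \<in> weights \<Phi> \<inter> chamber \<Phi>p.
           (real_up_to_factor_on (alcove \<Phi>p) (dirichlet_f \<Phi> p) \<longleftrightarrow>
             (\<exists>w1 \<in> weyl_group \<Phi>. w1 p = - p)) \<and>
           (\<forall>w1 \<in> weyl_group \<Phi>. w1 p = - p \<longrightarrow>
             (\<exists>cs :: real \<Rightarrow> real.
               (lin_det w1 = -1 \<and> cs = sin \<or> lin_det w1 = 1 \<and> cs = cos) \<and>
               equal_up_to_factor_on UNIV (dirichlet_f \<Phi> p)
                 (\<lambda>x. of_real (\<Sum>w\<in>weyl_group \<Phi>. lin_det w * cs (2 * pi * (x \<bullet> w p))))))) \<and>
         (\<forall>p \<in> weights \<Phi> \<inter> closure (chamber \<Phi>p).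
           (real_up_to_factor_on (alcove \<Phi>p) (neumann_g \<Phi> p) \<longleftrightarrow>
             (\<exists>w1 \<in> weyl_group \<Phi>. w1 p = - p)) \<and>
           ((\<exists>w1 \<in> weyl_group \<Phi>. w1 p = - p) \<longrightarrow>
             equal_up_to_factor_on UNIV (neumann_g \<Phi> p)
               (\<lambda>x. of_real (\<Sum>w\<in>weyl_group \<Phi>. cos (2 * pi * (x \<bullet> w p))))))"
proof -
  let ?W = "weyl_group \<Phi>" and ?A = "alcove \<Phi>p"
  have "finite \<Phi>"
    using assms(1) by (simp add: root_system_def)
  have "finite \<Phi>p"
    using \<open>finite \<Phi>\<close> assms(4) by (auto simp: positive_system_def)
  have A: "open ?A" "?A \<noteq> {}"
    using open_alcove[OF \<open>finite \<Phi>p\<close>] alcove_nonempty[OF \<open>finite \<Phi>\<close> assms(4)] by auto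
  \<comment> \<open>The hypothesis left open is that the coefficients are 1 on the stabilizer of
    \<open>p\<close>. For the Dirichlet case it follows from \<open>p\<close> lying in the chamber;
    in the Neumann case all coefficients are 1.\<close>
  note orbit = real_weyl_sum_imp_neg_in_orbit[OF finite_weyl_group[OF assms(1)] weyl_id _ A]
  have det_comp: "lin_det (v \<circ> w) = lin_det v * lin_det w" if "v \<in> ?W" for v w
    using that by (simp add: lin_det_comp weyl_group_linear)
  have cnj_f: "cnj (dirichlet_f \<Phi> p x) = of_real (lin_det w1) * dirichlet_f \<Phi> p x"
    if "w1 \<in> ?W" "w1 p = - p" for w1 p x
    unfolding dirichlet_f_eq_weyl_sum
    by (rule cnj_weyl_sum_neg_in_orbit[OF det_comp weyl_group_lin_det_square[OF assms(1)] that])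
  have f_cases: "(lin_det w1 = -1 \<and> (\<forall>x. dirichlet_f \<Phi> p x =
        \<i> * of_real (\<Sum>w\<in>?W. lin_det w * sin (2 * pi * (x \<bullet> w p))))) \<or>
      (lin_det w1 = 1 \<and> (\<forall>x. dirichlet_f \<Phi> p x =
        of_real (\<Sum>w\<in>?W. lin_det w * cos (2 * pi * (x \<bullet> w p)))))"
    if w1: "w1 \<in> ?W" "w1 p = - p" for w1 p
  proof -
    have "lin_det w1 = 1 \<or> lin_det w1 = -1"
      using weyl_group_lin_det_square[OF assms(1) w1(1)] by (simp add: square_eq_1_iff)
    then show ?thesis
    proof
      assume "lin_det w1 = 1"
      moreover from this have "cnj (dirichlet_f \<Phi> p x) = dirichlet_f \<Phi> p x" for x
        using cnj_f[OF w1] by simp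
      ultimately show ?thesis
        unfolding dirichlet_f_eq_weyl_sum by (intro disjI2 conjI allI weyl_sum_eq_cos_sum)
    next
      assume "lin_det w1 = -1"
      moreover from this have "cnj (dirichlet_f \<Phi> p x) = - dirichlet_f \<Phi> p x" for x
        using cnj_f[OF w1] by simp
      ultimately show ?thesis
        unfolding dirichlet_f_eq_weyl_sum by (intro disjI1 conjI allI weyl_sum_eq_sin_sum)
    qed
  qed
  have f_real: "real_up_to_factor_on ?A (dirichlet_f \<Phi> p)" if "w1 \<in> ?W" "w1 p = - p" for w1 p
    using f_cases[OF that]
  proof (elim disjE conjE)
    assume "\<forall>x. dirichlet_f \<Phi> p x =
      \<i> * of_real (\<Sum>w\<in>?W. lin_det w * sin (2 * pi * (x \<bullet> w p)))"
    \<comment> \<open>The function is i times a real sum, so a further factor i makes it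
      real.\<close>
    then have "\<i> * dirichlet_f \<Phi> p x = of_real (- (\<Sum>w\<in>?W. lin_det w * sin (2 * pi * (x \<bullet> w p))))" for x
      by simp
    then have "\<i> * dirichlet_f \<Phi> p x \<in> \<real>" for x
      by (metis Reals_of_real)
    then show ?thesis
      unfolding real_up_to_factor_on_def by (intro exI[of _ \<i>]) simp
  next
    assume "\<forall>x. dirichlet_f \<Phi> p x = of_real (\<Sum>w\<in>?W. lin_det w * cos (2 * pi * (x \<bullet> w p)))"
    then have "dirichlet_f \<Phi> p x \<in> \<real>" for x
      by (metis Reals_of_real)
    then show ?thesis
      unfolding real_up_to_factor_on_def by (intro exI[of _ 1]) simp
  qed
  \<comment> \<open>The constant is i for the sine sum and 1 for the cosine sum, and the identities
    hold on the whole space.\<close>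
  have f_factor: "\<exists>cs :: real \<Rightarrow> real. (lin_det w1 = -1 \<and> cs = sin \<or> lin_det w1 = 1 \<and> cs = cos) \<and>
      equal_up_to_factor_on UNIV (dirichlet_f \<Phi> p)
        (\<lambda>x. of_real (\<Sum>w\<in>?W. lin_det w * cs (2 * pi * (x \<bullet> w p))))"
    if "w1 \<in> ?W" "w1 p = - p" for w1 p
    using f_cases[OF that]
  proof (elim disjE conjE)
    assume "lin_det w1 = -1" and "\<forall>x. dirichlet_f \<Phi> p x =
      \<i> * of_real (\<Sum>w\<in>?W. lin_det w * sin (2 * pi * (x \<bullet> w p)))"
    then show ?thesis
      unfolding equal_up_to_factor_on_def
      by (intro exI[of _ sin] conjI disjI1 exI[of _ \<i>]) auto
  next
    assume "lin_det w1 = 1" and "\<forall>x. dirichlet_f \<Phi> p x =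
      of_real (\<Sum>w\<in>?W. lin_det w * cos (2 * pi * (x \<bullet> w p)))"
    then show ?thesis
      unfolding equal_up_to_factor_on_def
      by (intro exI[of _ cos] conjI disjI2 exI[of _ 1]) auto
  qed
  have g_cos: "neumann_g \<Phi> p x = of_real (\<Sum>w\<in>?W. cos (2 * pi * (x \<bullet> w p)))"
    if "w1 \<in> ?W" "w1 p = - p" for w1 p x
  proof -
    have "cnj (neumann_g \<Phi> p x) = of_real 1 * neumann_g \<Phi> p x"
      unfolding neumann_g_eq_weyl_sum
      by (rule cnj_weyl_sum_neg_in_orbit[OF _ _ that]) simp_all
    then show ?thesis
      using weyl_sum_eq_cos_sum[of ?W "\<lambda>_. 1" p x] by (simp add: neumann_g_eq_weyl_sum)
  qed
  have g_real: "real_up_to_factor_on ?A (neumann_g \<Phi> p)" if "w1 \<in> ?W" "w1 p = - p" for w1 p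
    unfolding real_up_to_factor_on_def g_cos[OF that] by (intro exI[of _ 1]) simp
  have g_factor: "equal_up_to_factor_on UNIV (neumann_g \<Phi> p)
      (\<lambda>x. of_real (\<Sum>w\<in>?W. cos (2 * pi * (x \<bullet> w p))))" if "w1 \<in> ?W" "w1 p = - p" for w1 p
    unfolding equal_up_to_factor_on_def g_cos[OF that] by (intro exI[of _ 1]) simp
  have f_orbit: "\<exists>w1\<in>?W. w1 p = - p"
    if "p \<in> chamber \<Phi>p" "real_up_to_factor_on ?A (dirichlet_f \<Phi> p)" for p
    using that lin_det_stabilizer_chamber[OF assms(1,4)]
    by (intro orbit[of p lin_det]) (auto simp: dirichlet_f_eq_weyl_sum)
  have g_orbit: "\<exists>w1\<in>?W. w1 p = - p" if "real_up_to_factor_on ?A (neumann_g \<Phi> p)" for p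
    using that by (intro orbit[of p "\<lambda>_. 1"]) (auto simp: neumann_g_eq_weyl_sum)
  show ?thesis
  proof (intro conjI ballI)
    fix p assume "p \<in> weights \<Phi> \<inter> chamber \<Phi>p"
    then show "real_up_to_factor_on ?A (dirichlet_f \<Phi> p) \<longleftrightarrow> (\<exists>w1\<in>?W. w1 p = - p)"
      using f_orbit f_real by blast
  next
    fix p w1 assume "w1 \<in> ?W"
    then show "w1 p = - p \<longrightarrow> (\<exists>cs :: real \<Rightarrow> real.
        (lin_det w1 = -1 \<and> cs = sin \<or> lin_det w1 = 1 \<and> cs = cos) \<and>
        equal_up_to_factor_on UNIV (dirichlet_f \<Phi> p)
          (\<lambda>x. of_real (\<Sum>w\<in>?W. lin_det w * cs (2 * pi * (x \<bullet> w p)))))"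
      using f_factor by blast
  next
    fix p
    show "real_up_to_factor_on ?A (neumann_g \<Phi> p) \<longleftrightarrow> (\<exists>w1\<in>?W. w1 p = - p)"
      using g_orbit g_real by blast
    show "(\<exists>w1\<in>?W. w1 p = - p) \<longrightarrow> equal_up_to_factor_on UNIV (neumann_g \<Phi> p)
        (\<lambda>x. of_real (\<Sum>w\<in>?W. cos (2 * pi * (x \<bullet> w p))))"
      using g_factor by blast
  qed
qed

end
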